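(* Let $1\le p,q<\infty$ and let $(\Omega,\Sigma,\mu)$ be a measure space such that there exist disjoint measurable sets $A,B\in\Sigma$ with $0<\mu(A)<\infty$ and $0<\mu(B)<\infty$. Then for every integer $N\ge 1$, $$\widetilde{R}_{p,N}(L^q(\mu))=0\quad\text{whenever } 1\le p<q<\infty\ \text{ or }\ 1\le q\le p<2.$$
   Context: Let $\mathbb{D}=\{z\in\mathbb{C}:|z|<1\}$. For a complex Banach space $X$, $H^{\infty}(\mathbb{D},X)$ is the space of bounded holomorphic functions $f:\mathbb{D}\to X$ with norm $\|f\|_{H^\infty(\mathbb{D},X)}=\sup_{|z|<1}\|f(z)\|$; write $f(z)=\sum_{k=0}^\infty x_kz^k$ with $x_k\in X$. The $p$-Bohr radius of order $N$ of $X$ ($1\le p<\infty$, $N\in\mathbb{N}$) is $\widetilde{R}_{p,N}(X)=\inf\{\widetilde{R}_{p,N}(f,X): \|f\|_{H^\infty(\mathbb{D},X)}\le 1\}$, where for $f(z)=\sum_{k\ge0}x_kz^k$ with $\|f\|_{H^\infty(\mathbb{D},X)}\le 1$, $\widetilde{R}_{p,N}(f,X)=\sup\{r\ge 0:\|x_0\|^p+\sum_{k=1}^N\|x_k\|^pr^{pk}\le 1\}$. Equivalently, it is the supremum of all $r\ge0$ such that $\left(\sum_{k=0}^N\|x_k\|^pr^{pk}\right)^{1/p}\le\|f\|_{H^\infty(\mathbb{D},X)}$ for every $f=\sum_k x_kz^k\in H^\infty(\mathbb{D},X)$. $L^q(\mu)$ is the usual complex Lebesgue space on $(\Omega,\Sigma,\mu)$.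 *)

theory Defs
  imports "HOL-Analysis.Analysis" "HOL-Algebra.Module"
begin

section \<open>Functions on the disc with values in a complex normed space\<close>

text \<open>
  The spaces \<open>L\<^sup>q(\<mu>)\<close> depend on a measure and an exponent, hence are not types. A complex normed
  space is therefore a record: a HOL-Algebra module over the complex numbers together with a norm.
  The ring multiplication and unit which the record type \<^typ>\<open>(complex, 'v) module\<close> inherits play
  no role.
\<close>

record 'v normed_module = "(complex, 'v) module" +
  vnorm :: "'v \<Rightarrow> real"

text \<open>Values of \<open>f\<close> outside the open unit disc are irrelevant in all of the following definitions.\<close>

definition vholomorphic :: "'v normed_module \<Rightarrow> (complex \<Rightarrow> 'v) \<Rightarrow> bool" where
  "vholomorphic X f \<longleftrightarrow>
     (\<forall>z\<in>ball 0 1. f z \<in> carrier X) \<and>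
     (\<forall>z\<in>ball 0 1. \<exists>d\<in>carrier X.
        ((\<lambda>w. vnorm X ((1 / (w - z)) \<odot>\<^bsub>X\<^esub> (f w \<ominus>\<^bsub>X\<^esub> f z) \<ominus>\<^bsub>X\<^esub> d)) \<longlongrightarrow> 0) (at z))"

definition Hinf :: "'v normed_module \<Rightarrow> (complex \<Rightarrow> 'v) set" where
  "Hinf X = {f. vholomorphic X f \<and> bdd_above ((\<lambda>z. vnorm X (f z)) ` ball 0 1)}"

definition Hinf_norm :: "'v normed_module \<Rightarrow> (complex \<Rightarrow> 'v) \<Rightarrow> real" where
  "Hinf_norm X f = (SUP z\<in>ball 0 1. vnorm X (f z))"

definition has_expansion :: "'v normed_module \<Rightarrow> (complex \<Rightarrow> 'v) \<Rightarrow> (nat \<Rightarrow> 'v) \<Rightarrow> bool" where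
  "has_expansion X f x \<longleftrightarrow>
     (\<forall>k. x k \<in> carrier X) \<and>
     (\<forall>z\<in>ball 0 1.
        (\<lambda>n. vnorm X (f z \<ominus>\<^bsub>X\<^esub> (\<Oplus>\<^bsub>X\<^esub>k\<in>{..<n}. (z ^ k) \<odot>\<^bsub>X\<^esub> x k))) \<longlonglongrightarrow> 0)"


section \<open>The \<open>p\<close>-Bohr radius of order \<open>N\<close>\<close>

text \<open>
  The radii are extended nonnegative reals, since the supremum is infinite when the coefficients
  \<open>x\<^sub>1, \<dots>, x\<^sub>N\<close> vanish. In a Banach space every holomorphic \<open>f\<close> has exactly one expansion, so the
  quantifier over \<open>x\<close> merely names the coefficients of \<open>f\<close>.
\<close>

definition bohr_radius_of ::
    "real \<Rightarrow> nat \<Rightarrow> 'v normed_module \<Rightarrow> (complex \<Rightarrow> 'v) \<Rightarrow> ennreal" where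
  "bohr_radius_of p N X f =
     (SUP r \<in> {r. 0 \<le> r \<and> (\<forall>x. has_expansion X f x \<longrightarrow>
         vnorm X (x 0) powr p + (\<Sum>k=1..N. vnorm X (x k) powr p * r powr (p * real k)) \<le> 1)}.
       ennreal r)"

definition bohr_radius :: "real \<Rightarrow> nat \<Rightarrow> 'v normed_module \<Rightarrow> ennreal" where
  "bohr_radius p N X = (INF f \<in> {f \<in> Hinf X. Hinf_norm X f \<le> 1}. bohr_radius_of p N X f)"


section \<open>The complex space \<open>L\<^sup>q(\<mu>)\<close>\<close>

definition Lq_funs :: "'a measure \<Rightarrow> real \<Rightarrow> ('a \<Rightarrow> complex) set" where
  "Lq_funs M q = {f \<in> borel_measurable M. integrable M (\<lambda>t. cmod (f t) powr q)}"

definition ae_class :: "'a measure \<Rightarrow> ('a \<Rightarrow> complex) \<Rightarrow> ('a \<Rightarrow> complex) set" where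
  "ae_class M f = {g \<in> borel_measurable M. AE t in M. g t = f t}"

definition ae_rep :: "('a \<Rightarrow> complex) set \<Rightarrow> ('a \<Rightarrow> complex)" where
  "ae_rep F = (SOME f. f \<in> F)"

definition Lq :: "'a measure \<Rightarrow> real \<Rightarrow> ('a \<Rightarrow> complex) set normed_module" where
  "Lq M q =
     \<lparr>carrier = ae_class M ` Lq_funs M q,
      mult = undefined,
      one = undefined,
      zero = ae_class M (\<lambda>t. 0),
      add = (\<lambda>F G. ae_class M (\<lambda>t. ae_rep F t + ae_rep G t)),
      smult = (\<lambda>c F. ae_class M (\<lambda>t. c * ae_rep F t)),
      vnorm = (\<lambda>F. (LINT t|M. cmod (ae_rep F t) powr q) powr (1 / q))\<rparr>"


subsection \<open>Independence of representatives and vector space structure\<close>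

lemma ae_class_eqI:
  assumes "AE t in M. f t = g t"
  shows "ae_class M f = ae_class M g"
  unfolding ae_class_def using assms by (auto elim: AE_mp)

lemma ae_rep_AE:
  assumes "f \<in> borel_measurable M"
  shows "ae_rep (ae_class M f) \<in> borel_measurable M"
    and "AE t in M. ae_rep (ae_class M f) t = f t"
proof -
  have "f \<in> ae_class M f"
    using assms by (auto simp: ae_class_def)
  then have "ae_rep (ae_class M f) \<in> ae_class M f"
    unfolding ae_rep_def by (rule someI[where P = "\<lambda>g. g \<in> ae_class M f"])
  then show "ae_rep (ae_class M f) \<in> borel_measurable M"
    and "AE t in M. ae_rep (ae_class M f) t = f t"
    by (auto simp: ae_class_def)
qed

lemma Lq_funs_measurable: "f \<in> Lq_funs M q \<Longrightarrow> f \<in> borel_measurable M"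
  by (simp add: Lq_funs_def)

lemma Lq_add:
  assumes "f \<in> borel_measurable M" "g \<in> borel_measurable M"
  shows "ae_class M f \<oplus>\<^bsub>Lq M q\<^esub> ae_class M g = ae_class M (\<lambda>t. f t + g t)"
proof -
  have "AE t in M. ae_rep (ae_class M f) t + ae_rep (ae_class M g) t = f t + g t"
    using ae_rep_AE(2)[OF assms(1)] ae_rep_AE(2)[OF assms(2)] by eventually_elim simp
  then show ?thesis
    by (simp add: Lq_def ae_class_eqI)
qed

lemma Lq_smult:
  assumes "f \<in> borel_measurable M"
  shows "c \<odot>\<^bsub>Lq M q\<^esub> ae_class M f = ae_class M (\<lambda>t. c * f t)"
proof -
  have "AE t in M. c * ae_rep (ae_class M f) t = c * f t"
    using ae_rep_AE(2)[OF assms] by eventually_elim simp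
  then show ?thesis
    by (simp add: Lq_def ae_class_eqI)
qed

lemma Lq_vnorm:
  assumes "f \<in> borel_measurable M"
  shows "vnorm (Lq M q) (ae_class M f) = (LINT t|M. cmod (f t) powr q) powr (1 / q)"
proof -
  have "(LINT t|M. cmod (ae_rep (ae_class M f) t) powr q) = (LINT t|M. cmod (f t) powr q)"
  proof (rule integral_cong_AE)
    show "AE t in M. cmod (ae_rep (ae_class M f) t) powr q = cmod (f t) powr q"
      using ae_rep_AE(2)[OF assms] by eventually_elim simp
  qed (use assms ae_rep_AE(1)[OF assms] in measurable)
  then show ?thesis
    by (simp add: Lq_def)
qed

lemma Lq_funs_zero: "(\<lambda>t. 0) \<in> Lq_funs M q"
  by (simp add: Lq_funs_def)

lemma Lq_funs_scale:
  assumes "f \<in> Lq_funs M q"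
  shows "(\<lambda>t. c * f t) \<in> Lq_funs M q"
  using assms by (auto simp: Lq_funs_def norm_mult powr_mult)

lemma Lq_funs_add:
  assumes "0 < q" "f \<in> Lq_funs M q" "g \<in> Lq_funs M q"
  shows "(\<lambda>t. f t + g t) \<in> Lq_funs M q"
proof -
  have [measurable]: "f \<in> borel_measurable M" "g \<in> borel_measurable M"
    using assms by (auto simp: Lq_funs_def)
  have "integrable M (\<lambda>t. 2 powr q * (cmod (f t) powr q + cmod (g t) powr q))"
    using assms by (auto simp: Lq_funs_def)
  then have "integrable M (\<lambda>t. cmod (f t + g t) powr q)"
  proof (rule Bochner_Integration.integrable_bound)
    have "norm (cmod (f t + g t) powr q)
        \<le> norm (2 powr q * (cmod (f t) powr q + cmod (g t) powr q))" for t
    proof -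
      have "cmod (f t + g t) \<le> 2 * max (cmod (f t)) (cmod (g t))"
        using norm_triangle_ineq[of "f t" "g t"] by linarith
      then have "cmod (f t + g t) powr q \<le> (2 * max (cmod (f t)) (cmod (g t))) powr q"
        using assms(1) by (intro powr_mono2) auto
      also have "\<dots> = 2 powr q * max (cmod (f t)) (cmod (g t)) powr q"
        by (simp add: powr_mult)
      also have "\<dots> \<le> 2 powr q * (cmod (f t) powr q + cmod (g t) powr q)"
        by (intro mult_left_mono) (auto simp: max_def)
      finally show ?thesis
        by simp
    qed
    then show "AE t in M. norm (cmod (f t + g t) powr q)
        \<le> norm (2 powr q * (cmod (f t) powr q + cmod (g t) powr q))"
      by simp
  qed measurable
  then show ?thesis
    by (simp add: Lq_funs_def)
qed

definition complex_ring :: "complex ring" where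
  "complex_ring = \<lparr>carrier = UNIV, mult = (*), one = 1, zero = 0, add = (+)\<rparr>"

lemma cring_complex_ring: "cring complex_ring"
proof (rule cringI)
  show "abelian_group complex_ring"
  proof (rule abelian_groupI)
    fix x assume "x \<in> carrier complex_ring"
    show "\<exists>y\<in>carrier complex_ring. y \<oplus>\<^bsub>complex_ring\<^esub> x = \<zero>\<^bsub>complex_ring\<^esub>"
      by (rule bexI[of _ "- x"]) (auto simp: complex_ring_def)
  qed (auto simp: complex_ring_def)
  show "comm_monoid complex_ring"
    by (rule comm_monoidI) (auto simp: complex_ring_def)
qed (auto simp: complex_ring_def algebra_simps)

lemma module_Lq:
  assumes "0 < q"
  shows "Module.module complex_ring (Lq M q)"
proof -
  note [simp] = Lq_add Lq_smult Lq_funs_measurable borel_measurable_add borel_measurable_times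
  have car: "carrier (Lq M q) = ae_class M ` Lq_funs M q"
    and zero: "\<zero>\<^bsub>Lq M q\<^esub> = ae_class M (\<lambda>t. 0)"
    by (simp_all add: Lq_def)
  have "abelian_group (Lq M q)"
  proof (rule abelian_groupI)
    fix x assume "x \<in> carrier (Lq M q)"
    then obtain f where f: "f \<in> Lq_funs M q" "x = ae_class M f"
      by (auto simp: car)
    then have "ae_class M (\<lambda>t. (- 1) * f t) \<in> carrier (Lq M q)"
      using Lq_funs_scale[of f M q "- 1"] unfolding car by blast
    moreover have "ae_class M (\<lambda>t. (- 1) * f t) \<oplus>\<^bsub>Lq M q\<^esub> x = \<zero>\<^bsub>Lq M q\<^esub>"
      using f by (simp add: zero)
    ultimately show "\<exists>y\<in>carrier (Lq M q). y \<oplus>\<^bsub>Lq M q\<^esub> x = \<zero>\<^bsub>Lq M q\<^esub>"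
      by blast
  qed (use assms in \<open>auto simp: car zero Lq_funs_zero Lq_funs_add add_ac\<close>)
  then show ?thesis
    using cring_complex_ring
    by (intro moduleI)
       (auto simp: car complex_ring_def Lq_funs_scale algebra_simps)
qed

end

theory Submission
  imports Defs
begin

text \<open>
  Affine functions \<open>f(z) = x\<^sub>0 + z x\<^sub>1\<close> with values in the copy of \<open>\<ell>\<^sup>q\<^sub>2\<close> spanned by the
  normalised indicators of \<open>A\<close> and \<open>B\<close> suffice. If \<open>p < q\<close>, take
  \<open>f(z) = ((1 - \<delta>\<^sup>q)\<^bsup>1/q\<^esup>, \<delta> z)\<close>: the zeroth coefficient loses only \<open>O(\<delta>\<^sup>q)\<close> while the first one
  contributes \<open>\<delta>\<^sup>p r\<^sup>p\<close>. If \<open>q \<le> p < 2\<close>, take \<open>f(z) = c (1 + \<delta> z, 1 - \<delta> z)\<close>: since the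
  \<open>q\<close>-mean is at most the quadratic mean, the parallelogram law makes
  \<open>c = 2\<^bsup>-1/q\<^esup> (1 + \<delta>\<^sup>2)\<^bsup>-1/2\<^esup>\<close> admissible, and the loss \<open>O(\<delta>\<^sup>2)\<close> is again dominated by
  \<open>\<delta>\<^sup>p r\<^sup>p\<close>.
\<close>

section \<open>Affine functions\<close>

lemma affine_minus_affine:
  assumes "Module.module complex_ring X" "x0 \<in> carrier X" "x1 \<in> carrier X"
  shows "(x0 \<oplus>\<^bsub>X\<^esub> w \<odot>\<^bsub>X\<^esub> x1) \<ominus>\<^bsub>X\<^esub> (x0 \<oplus>\<^bsub>X\<^esub> z \<odot>\<^bsub>X\<^esub> x1) = (w - z) \<odot>\<^bsub>X\<^esub> x1"
proof -
  interpret X: Module.module complex_ring X by fact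
  have U: "c \<in> carrier complex_ring" for c by (simp add: complex_ring_def)
  have closed: "c \<odot>\<^bsub>X\<^esub> x1 \<in> carrier X" for c
    using assms U by (intro X.smult_closed)
  have "w \<odot>\<^bsub>X\<^esub> x1 = ((w - z) \<oplus>\<^bsub>complex_ring\<^esub> z) \<odot>\<^bsub>X\<^esub> x1"
    by (simp add: complex_ring_def)
  also have "\<dots> = (w - z) \<odot>\<^bsub>X\<^esub> x1 \<oplus>\<^bsub>X\<^esub> z \<odot>\<^bsub>X\<^esub> x1"
    using assms U by (intro X.smult_l_distr)
  finally have "x0 \<oplus>\<^bsub>X\<^esub> w \<odot>\<^bsub>X\<^esub> x1 = (w - z) \<odot>\<^bsub>X\<^esub> x1 \<oplus>\<^bsub>X\<^esub> (x0 \<oplus>\<^bsub>X\<^esub> z \<odot>\<^bsub>X\<^esub> x1)"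
    using assms closed by (simp add: X.a_ac)
  then show ?thesis
    using assms closed by (simp add: X.minus_eq X.a_assoc X.r_neg)
qed

text \<open>For \<open>w \<noteq> z\<close> the difference quotient is exactly \<open>x1\<close>, so
  the error term is constantly the norm of zero.\<close>

lemma vholomorphic_affine:
  assumes "Module.module complex_ring X" "vnorm X \<zero>\<^bsub>X\<^esub> = 0" "x0 \<in> carrier X" "x1 \<in> carrier X"
  shows "vholomorphic X (\<lambda>z. x0 \<oplus>\<^bsub>X\<^esub> z \<odot>\<^bsub>X\<^esub> x1)"
proof -
  interpret X: Module.module complex_ring X by fact
  have U: "c \<in> carrier complex_ring" for c by (simp add: complex_ring_def)
  have closed: "c \<odot>\<^bsub>X\<^esub> x1 \<in> carrier X" for c
    using assms U by (intro X.smult_closed)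
  have quotient: "(1 / (w - z)) \<odot>\<^bsub>X\<^esub> ((x0 \<oplus>\<^bsub>X\<^esub> w \<odot>\<^bsub>X\<^esub> x1) \<ominus>\<^bsub>X\<^esub> (x0 \<oplus>\<^bsub>X\<^esub> z \<odot>\<^bsub>X\<^esub> x1))
      \<ominus>\<^bsub>X\<^esub> x1 = \<zero>\<^bsub>X\<^esub>"
    if "w \<noteq> z" for w z
  proof -
    have "(1 / (w - z)) \<odot>\<^bsub>X\<^esub> ((w - z) \<odot>\<^bsub>X\<^esub> x1)
        = ((1 / (w - z)) \<otimes>\<^bsub>complex_ring\<^esub> (w - z)) \<odot>\<^bsub>X\<^esub> x1"
      using assms U by (intro X.smult_assoc1[symmetric])
    also have "(1 / (w - z)) \<otimes>\<^bsub>complex_ring\<^esub> (w - z) = \<one>\<^bsub>complex_ring\<^esub>"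
      using that by (simp add: complex_ring_def)
    finally show ?thesis
      using assms unfolding affine_minus_affine[OF assms(1,3,4)]
      by (simp add: X.minus_eq X.r_neg)
  qed
  have "((\<lambda>w. vnorm X ((1 / (w - z)) \<odot>\<^bsub>X\<^esub>
      ((x0 \<oplus>\<^bsub>X\<^esub> w \<odot>\<^bsub>X\<^esub> x1) \<ominus>\<^bsub>X\<^esub> (x0 \<oplus>\<^bsub>X\<^esub> z \<odot>\<^bsub>X\<^esub> x1)) \<ominus>\<^bsub>X\<^esub> x1)) \<longlongrightarrow> 0) (at z)" for z
    by (rule tendsto_eventually) (auto simp: eventually_at_filter quotient assms(2))
  then show ?thesis
    using assms closed unfolding vholomorphic_def by blast
qed

text \<open>Every partial sum with at least two terms already equals the function, so the error is
  eventually the norm of zero.\<close>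

lemma has_expansion_affine:
  assumes "Module.module complex_ring X" "vnorm X \<zero>\<^bsub>X\<^esub> = 0" "x0 \<in> carrier X" "x1 \<in> carrier X"
  shows "has_expansion X (\<lambda>z. x0 \<oplus>\<^bsub>X\<^esub> z \<odot>\<^bsub>X\<^esub> x1)
    (\<lambda>k. if k = 0 then x0 else if k = 1 then x1 else \<zero>\<^bsub>X\<^esub>)"
    (is "has_expansion X ?f ?x")
proof -
  interpret X: Module.module complex_ring X by fact
  have U: "c \<in> carrier complex_ring" for c by (simp add: complex_ring_def)
  have one: "1 \<odot>\<^bsub>X\<^esub> x0 = x0"
    using X.smult_one[OF assms(3)] by (simp add: complex_ring_def)
  have closed: "c \<odot>\<^bsub>X\<^esub> x \<in> carrier X" if "x \<in> carrier X" for c x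
    using that U by (intro X.smult_closed)
  have null: "c \<odot>\<^bsub>X\<^esub> \<zero>\<^bsub>X\<^esub> = \<zero>\<^bsub>X\<^esub>" for c
    using U by (intro X.smult_r_null)
  have partial_sum: "(\<Oplus>\<^bsub>X\<^esub>k\<in>{..<n + 2}. (z ^ k) \<odot>\<^bsub>X\<^esub> ?x k) = ?f z" for z n
  proof (induction n)
    case 0
    have "{..<0 + 2} = insert 1 (insert (0::nat) {})" by auto
    then show ?case
      using assms by (simp add: closed one X.a_comm)
  next
    case (Suc n)
    have "{..<Suc n + 2} = insert (n + 2) {..<n + 2}" by auto
    then show ?case
      using Suc assms by (simp add: closed null)
  qed
  have "(\<lambda>n. vnorm X (?f z \<ominus>\<^bsub>X\<^esub> (\<Oplus>\<^bsub>X\<^esub>k\<in>{..<n}. (z ^ k) \<odot>\<^bsub>X\<^esub> ?x k))) \<longlonglongrightarrow> 0" for z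
  \<comment> \<open>The shift by 2 skips \<open>n = 0\<close> and \<open>n = 1\<close>, whose
    partial sums lack a coefficient.\<close>
  proof (rule LIMSEQ_offset[where k = 2])
    show "(\<lambda>n. vnorm X (?f z \<ominus>\<^bsub>X\<^esub> (\<Oplus>\<^bsub>X\<^esub>k\<in>{..<n + 2}. (z ^ k) \<odot>\<^bsub>X\<^esub> ?x k))) \<longlonglongrightarrow> 0"
      unfolding partial_sum using assms closed by (simp add: X.minus_eq X.r_neg)
  qed
  then show ?thesis
    using assms unfolding has_expansion_def by auto
qed

text \<open>The radius is an infimum, so one test function bounds it from above. A radius admissible
  for that function must lie below \<rho>, since the two-term sum increases with the radius and
  already exceeds 1 at \<rho>.\<close>

lemma bohr_radius_le_affine:
  assumes "Module.module complex_ring X" "vnorm X \<zero>\<^bsub>X\<^esub> = 0" "x0 \<in> carrier X" "x1 \<in> carrier X"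
    and bound: "\<And>z. cmod z < 1 \<Longrightarrow> vnorm X (x0 \<oplus>\<^bsub>X\<^esub> z \<odot>\<^bsub>X\<^esub> x1) \<le> 1"
    and "0 < p" "1 \<le> N" "0 \<le> \<rho>"
    and exceeds: "1 < vnorm X x0 powr p + vnorm X x1 powr p * \<rho> powr p"
  shows "bohr_radius p N X \<le> ennreal \<rho>"
proof -
  define f where "f = (\<lambda>z. x0 \<oplus>\<^bsub>X\<^esub> z \<odot>\<^bsub>X\<^esub> x1)"
  define x where "x = (\<lambda>k::nat. if k = 0 then x0 else if k = 1 then x1 else \<zero>\<^bsub>X\<^esub>)"
  have "bdd_above ((\<lambda>z. vnorm X (f z)) ` ball 0 1)"
    by (rule bdd_aboveI[where M = 1]) (auto simp: f_def bound)
  moreover have "Hinf_norm X f \<le> 1"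
    unfolding Hinf_norm_def by (rule cSUP_least) (auto simp: f_def bound)
  ultimately have "f \<in> {f \<in> Hinf X. Hinf_norm X f \<le> 1}"
    using vholomorphic_affine[OF assms(1-4)] by (simp add: Hinf_def f_def)
  then have "bohr_radius p N X \<le> bohr_radius_of p N X f"
    unfolding bohr_radius_def by (rule INF_lower)
  also have "\<dots> \<le> ennreal \<rho>"
    unfolding bohr_radius_of_def
  proof (rule SUP_least)
    fix r assume r: "r \<in> {r. 0 \<le> r \<and> (\<forall>x. has_expansion X f x \<longrightarrow>
         vnorm X (x 0) powr p + (\<Sum>k=1..N. vnorm X (x k) powr p * r powr (p * real k)) \<le> 1)}"
    have "has_expansion X f x"
      using has_expansion_affine[OF assms(1-4)] by (simp add: f_def x_def)
    with r have le1: "vnorm X (x 0) powr p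
        + (\<Sum>k=1..N. vnorm X (x k) powr p * r powr (p * real k)) \<le> 1"
      by blast
    \<comment> \<open>All terms are nonnegative, and \<open>1 \<le> N\<close> puts the index 1 into
      the range of summation.\<close>
    have "vnorm X (x 1) powr p * r powr (p * real 1)
        \<le> (\<Sum>k=1..N. vnorm X (x k) powr p * r powr (p * real k))"
      using \<open>1 \<le> N\<close> by (intro member_le_sum) auto
    with le1 have "vnorm X x0 powr p + vnorm X x1 powr p * r powr p \<le> 1"
      by (simp add: x_def)
    with exceeds have "vnorm X x1 powr p * r powr p < vnorm X x1 powr p * \<rho> powr p"
      by linarith
    then have "r powr p < \<rho> powr p"
      by (meson mult_left_mono not_le powr_ge_zero)
    then have "r < \<rho>"
      using \<open>0 < p\<close> \<open>0 \<le> \<rho>\<close> by (meson not_le powr_mono2 less_imp_le)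
    then show "ennreal r \<le> ennreal \<rho>"
      by (simp add: ennreal_leI)
  qed
  finally show ?thesis .
qed


section \<open>Two-dimensional subspaces of \<open>L\<^sup>q\<close>\<close>

text \<open>The denominators turn both indicators into unit vectors, so that \<open>a\<close> and
  \<open>b\<close> are isometric coordinates.\<close>

definition two_step :: "'a measure \<Rightarrow> real \<Rightarrow> 'a set \<Rightarrow> 'a set \<Rightarrow> complex \<Rightarrow> complex \<Rightarrow> 'a \<Rightarrow> complex"
  where "two_step M q A B a b t =
    a * (indicator A t / measure M A powr (1 / q)) + b * (indicator B t / measure M B powr (1 / q))"

lemma two_step_affine:
  "two_step M q A B a b t + z * two_step M q A B c d t = two_step M q A B (a + z * c) (b + z * d) t"
  by (simp add: two_step_def algebra_simps add_divide_distrib)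

text \<open>By disjointness at most one summand is nonzero at each point, so the power passes
  through the sum.\<close>

lemma cmod_two_step_powr:
  assumes "A \<inter> B = {}" "0 < q"
  shows "cmod (two_step M q A B a b t) powr q
    = cmod a powr q / measure M A * indicator A t + cmod b powr q / measure M B * indicator B t"
  using assms
  by (auto simp: two_step_def indicator_def norm_mult norm_divide powr_divide powr_powr)

lemma
  assumes "0 < q" "A \<in> sets M" "B \<in> sets M" "A \<inter> B = {}"
    "0 < emeasure M A" "emeasure M A < \<infinity>" "0 < emeasure M B" "emeasure M B < \<infinity>"
  shows two_step_Lq_funs: "two_step M q A B a b \<in> Lq_funs M q"
    and vnorm_two_step:
      "vnorm (Lq M q) (ae_class M (two_step M q A B a b)) = (cmod a powr q + cmod b powr q) powr (1 / q)"
proof -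
  note [measurable] = assms(2,3)
  have measurable: "two_step M q A B a b \<in> borel_measurable M"
    unfolding two_step_def by measurable
  \<comment> \<open>\<open>measure\<close> is 0 on sets of infinite measure, so finiteness enters
    here along with positivity.\<close>
  have pos: "0 < measure M A" "0 < measure M B"
    using assms by (simp_all add: measure_def enn2real_positive_iff)
  show "two_step M q A B a b \<in> Lq_funs M q"
    using assms measurable by (simp add: Lq_funs_def cmod_two_step_powr)
  have "(LINT t|M. cmod (two_step M q A B a b t) powr q) = cmod a powr q + cmod b powr q"
    using assms pos by (simp add: cmod_two_step_powr)
  then show "vnorm (Lq M q) (ae_class M (two_step M q A B a b))
      = (cmod a powr q + cmod b powr q) powr (1 / q)"
    by (simp add: Lq_vnorm[OF measurable])
qed

text \<open>Reduces the problem to four complex numbers, the coordinates of the two coefficients.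
  The exponent \<open>p / q\<close> is the \<open>p\<close>-th power of a norm that is itself a
  \<open>1 / q\<close>-th power.\<close>

lemma bohr_radius_Lq_le:
  fixes a0 b0 a1 b1 :: complex
  assumes "0 < q" "A \<in> sets M" "B \<in> sets M" "A \<inter> B = {}"
    "0 < emeasure M A" "emeasure M A < \<infinity>" "0 < emeasure M B" "emeasure M B < \<infinity>"
    and "0 < p" "1 \<le> N" "0 \<le> \<rho>"
    and bound: "\<And>z. cmod z < 1 \<Longrightarrow> cmod (a0 + z * a1) powr q + cmod (b0 + z * b1) powr q \<le> 1"
    and exceeds: "1 < (cmod a0 powr q + cmod b0 powr q) powr (p / q)
      + (cmod a1 powr q + cmod b1 powr q) powr (p / q) * \<rho> powr p"
  shows "bohr_radius p N (Lq M q) \<le> ennreal \<rho>"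
proof -
  let ?e = "\<lambda>a b. ae_class M (two_step M q A B a b)"
  note funs = two_step_Lq_funs[OF assms(1-8)]
  note vnorm = vnorm_two_step[OF assms(1-8)]
  have carrier: "?e a b \<in> carrier (Lq M q)" for a b
    using funs by (simp add: Lq_def)
  have meas: "two_step M q A B a b \<in> borel_measurable M" for a b
    using funs by (rule Lq_funs_measurable)
  have affine: "?e a0 b0 \<oplus>\<^bsub>Lq M q\<^esub> z \<odot>\<^bsub>Lq M q\<^esub> ?e a1 b1 = ?e (a0 + z * a1) (b0 + z * b1)" for z
    using meas by (simp add: Lq_smult Lq_add two_step_affine)
  show ?thesis
  proof (rule bohr_radius_le_affine[of _ "?e a0 b0" "?e a1 b1"])
    show "vnorm (Lq M q) \<zero>\<^bsub>Lq M q\<^esub> = 0"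
      using Lq_vnorm[of "\<lambda>t. 0" M q] by (simp add: Lq_def)
    show "vnorm (Lq M q) (?e a0 b0 \<oplus>\<^bsub>Lq M q\<^esub> z \<odot>\<^bsub>Lq M q\<^esub> ?e a1 b1) \<le> 1" if "cmod z < 1" for z
      using bound[OF that] \<open>0 < q\<close> by (simp add: affine vnorm powr_le1)
    show "1 < vnorm (Lq M q) (?e a0 b0) powr p + vnorm (Lq M q) (?e a1 b1) powr p * \<rho> powr p"
      using exceeds by (simp add: vnorm powr_powr)
  qed (use assms carrier module_Lq in auto)
qed


section \<open>The two extremal families\<close>

lemma exists_powr_less:
  fixes s c :: real
  assumes "0 < s" "0 < c"
  shows "\<exists>\<delta>. 0 < \<delta> \<and> \<delta> < 1 \<and> \<delta> powr s < c"
proof -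
  \<comment> \<open>Halving \<open>c\<close> makes the final inequality strict; the minimum with
    \<open>1 / 2\<close> keeps \<delta> below 1.\<close>
  define \<delta> where "\<delta> = min (1 / 2) ((c / 2) powr (1 / s))"
  have "\<delta> powr s \<le> ((c / 2) powr (1 / s)) powr s"
    using assms by (intro powr_mono2) (auto simp: \<delta>_def)
  also have "\<dots> < c"
    using assms by (simp add: powr_powr)
  finally show ?thesis
    using assms by (intro exI[of _ \<delta>]) (auto simp: \<delta>_def)
qed

text \<open>Concavity of the power at 1, read off from Young's inequality with weights
  \<open>s\<close> and \<open>1 - s\<close>. Young's inequality is for positive numbers, hence the
  separate case \<open>t = 0\<close>.\<close>

lemma powr_le_tangent:
  fixes s t :: real
  assumes "0 \<le> s" "s \<le> 1" "0 \<le> t"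
  shows "t powr s \<le> 1 + s * (t - 1)"
  using Youngs_inequality_0[of s "1 - s" t 1] assms by (cases "t = 0") (auto simp: algebra_simps)

lemma two_point_le_quadratic_mean:
  fixes w :: complex
  assumes "0 \<le> q" "q \<le> 2"
  shows "cmod (1 + w) powr q + cmod (1 - w) powr q \<le> 2 * (1 + (cmod w)\<^sup>2) powr (q / 2)"
proof -
  define m where "m = 1 + (cmod w)\<^sup>2"
  have "0 < m" by (simp add: m_def add_pos_nonneg)
  \<comment> \<open>Here \<open>m\<close> is the mean of the squared moduli of \<open>1 + w\<close>
    and \<open>1 - w\<close>; dividing by it places the point of tangency at the average.\<close>
  have tangent: "x powr q \<le> m powr (q / 2) * (1 + q / 2 * (x\<^sup>2 / m - 1))" if "0 \<le> x" for x
  proof -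
    have "x powr q = (m * (x\<^sup>2 / m)) powr (q / 2)"
      using \<open>0 < m\<close> that by (cases "x = 0") (simp_all add: powr_powr flip: powr_numeral)
    also have "\<dots> = m powr (q / 2) * (x\<^sup>2 / m) powr (q / 2)"
      by (rule powr_mult)
    also have "\<dots> \<le> m powr (q / 2) * (1 + q / 2 * (x\<^sup>2 / m - 1))"
      using assms \<open>0 < m\<close> by (intro mult_left_mono powr_le_tangent) auto
    finally show ?thesis .
  qed
  have parallelogram: "(cmod (1 + w))\<^sup>2 + (cmod (1 - w))\<^sup>2 = 2 * m"
    unfolding m_def cmod_power2 by (simp add: power2_eq_square algebra_simps)
  have "cmod (1 + w) powr q + cmod (1 - w) powr q
      \<le> m powr (q / 2) * (1 + q / 2 * ((cmod (1 + w))\<^sup>2 / m - 1))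
        + m powr (q / 2) * (1 + q / 2 * ((cmod (1 - w))\<^sup>2 / m - 1))"
    by (intro add_mono tangent) auto
  \<comment> \<open>Collected in this way, the linear terms cancel by the parallelogram law.\<close>
  also have "\<dots> = m powr (q / 2) * (2 + q / 2 * (((cmod (1 + w))\<^sup>2 + (cmod (1 - w))\<^sup>2) / m - 2))"
    by (simp add: algebra_simps add_divide_distrib)
  also have "\<dots> = 2 * m powr (q / 2)"
    unfolding parallelogram using \<open>0 < m\<close> by simp
  finally show ?thesis
    by (simp add: m_def)
qed

theorem theorem2p7:
  fixes p q :: real and M :: "'a measure" and A B :: "'a set" and N :: nat
  assumes "1 \<le> p" and "1 \<le> q"
    and "A \<in> sets M" and "B \<in> sets M" and "A \<inter> B = {}"
    and "0 < emeasure M A" and "emeasure M A < \<infinity>"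
    and "0 < emeasure M B" and "emeasure M B < \<infinity>"
    and "1 \<le> N"
    and "p < q \<or> (q \<le> p \<and> p < 2)"
  shows "bohr_radius p N (Lq M q) = 0"
proof -
  have "0 < p" "0 < q" using assms by auto
  note Lq_le = bohr_radius_Lq_le[OF \<open>0 < q\<close> assms(3-9) \<open>0 < p\<close> \<open>1 \<le> N\<close>]
  have small: "bohr_radius p N (Lq M q) \<le> ennreal \<rho>" if "0 < \<rho>" for \<rho>
    using assms(11)
  proof
    assume "p < q"
    \<comment> \<open>Multiplied by \<open>\<delta> powr p\<close>, the last inequality says that
      the loss \<open>\<delta> powr q\<close> is smaller than the gain
      \<open>\<delta> powr p * \<rho> powr p\<close>.\<close>
    then obtain \<delta> where \<delta>: "0 < \<delta>" "\<delta> < 1" "\<delta> powr (q - p) < \<rho> powr p"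
      using exists_powr_less[of "q - p" "\<rho> powr p"] \<open>0 < \<rho>\<close> by auto
    have "\<delta> powr q < 1" "0 < \<delta> powr q"
      using \<delta> \<open>0 < q\<close> powr_less_mono2[of q \<delta> 1] by simp_all
    define a where "a = (1 - \<delta> powr q) powr (1 / q)"
    have a: "a powr q = 1 - \<delta> powr q" "0 \<le> a"
      using \<open>\<delta> powr q < 1\<close> \<open>0 < q\<close> by (simp_all add: a_def powr_powr)
    show ?thesis
    proof (rule Lq_le[of _ "of_real a" 0 0 "of_real \<delta>"])
      fix z :: complex assume "cmod z < 1"
      then have "cmod (z * of_real \<delta>) powr q \<le> \<delta> powr q"
        using \<delta> \<open>0 < q\<close> by (intro powr_mono2) (auto simp: norm_mult mult_left_le_one_le)
      then show "cmod (of_real a + z * 0) powr q + cmod (0 + z * of_real \<delta>) powr q \<le> 1"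
        using a by simp
    next
      have "\<delta> powr q = \<delta> powr p * \<delta> powr (q - p)"
        by (simp flip: powr_add)
      also have "\<dots> < \<delta> powr p * \<rho> powr p"
        using \<delta> by (intro mult_strict_left_mono) auto
      finally have "\<delta> powr q < \<delta> powr p * \<rho> powr p" .
      \<comment> \<open>For a base in the unit interval, lowering the exponent from 1 to
        \<open>p / q\<close> increases the power; this bounds the zeroth term from below by
        \<open>1 - \<delta> powr q\<close>.\<close>
      moreover have "(1 - \<delta> powr q) powr 1 \<le> (1 - \<delta> powr q) powr (p / q)"
        using \<open>\<delta> powr q < 1\<close> \<open>p < q\<close> \<open>0 < q\<close> by (intro powr_mono') auto
      ultimately show "1 < (cmod (of_real a) powr q + cmod 0 powr q) powr (p / q)
          + (cmod 0 powr q + cmod (of_real \<delta>) powr q) powr (p / q) * \<rho> powr p"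
        using a \<delta> \<open>\<delta> powr q < 1\<close> \<open>0 < q\<close> by (simp add: powr_powr)
    qed (use \<open>0 < \<rho>\<close> in auto)
  next
    assume pq: "q \<le> p \<and> p < 2"
    \<comment> \<open>Here the loss is of order
      \<open>\<delta>\<^sup>2 = \<delta> powr p * \<delta> powr (2 - p)\<close>, again below
      \<open>\<delta> powr p * \<rho> powr p\<close>.\<close>
    then obtain \<delta> where \<delta>: "0 < \<delta>" "\<delta> < 1" "\<delta> powr (2 - p) < \<rho> powr p"
      using exists_powr_less[of "2 - p" "\<rho> powr p"] \<open>0 < \<rho>\<close> by auto
    define m where "m = 1 + \<delta>\<^sup>2"
    \<comment> \<open>\<open>c powr q\<close> is the reciprocal of the largest value that the
      two-point inequality allows for \<open>cmod w \<le> \<delta>\<close>.\<close>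
    define c where "c = (2 * m powr (q / 2)) powr (- 1 / q)"
    have "0 < m" by (simp add: m_def add_pos_nonneg)
    then have "0 < c" by (simp add: c_def)
    have "c powr q = (2 * m powr (q / 2)) powr - 1"
      unfolding c_def powr_powr using \<open>0 < q\<close> by simp
    then have c_powr: "c powr q = inverse (2 * m powr (q / 2))"
      using \<open>0 < m\<close> unfolding powr_minus by simp
    have norm0: "(c powr q + c powr q) powr (p / q) = m powr (- (p / 2))"
    proof -
      have "c powr q + c powr q = m powr (- (q / 2))"
        using \<open>0 < m\<close> by (simp add: c_powr powr_minus field_simps)
      then show ?thesis
        using \<open>0 < q\<close> by (simp add: powr_powr)
    qed
    show ?thesis
    proof (rule Lq_le[of _ "of_real c" "of_real (c * \<delta>)" "of_real c" "of_real (- c * \<delta>)"])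
      fix z :: complex assume z: "cmod z < 1"
      define w where "w = z * of_real \<delta>"
      have "cmod w \<le> \<delta>"
        using z \<delta> by (simp add: w_def norm_mult mult_left_le_one_le)
      then have "1 + (cmod w)\<^sup>2 \<le> m"
        by (simp add: m_def power_mono)
      have eqs: "of_real c + z * of_real (c * \<delta>) = of_real c * (1 + w)"
        "of_real c + z * of_real (- c * \<delta>) = of_real c * (1 - w)"
        by (simp_all add: w_def algebra_simps)
      have "cmod (of_real c * (1 + w)) powr q + cmod (of_real c * (1 - w)) powr q
          = c powr q * (cmod (1 + w) powr q + cmod (1 - w) powr q)"
        unfolding distrib_left[of "c powr q"] using \<open>0 < c\<close> by (simp add: norm_mult powr_mult)
      also have "\<dots> \<le> c powr q * (2 * (1 + (cmod w)\<^sup>2) powr (q / 2))"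
        using pq \<open>0 < q\<close> by (intro mult_left_mono two_point_le_quadratic_mean) auto
      also have "\<dots> \<le> c powr q * (2 * m powr (q / 2))"
        using \<open>1 + (cmod w)\<^sup>2 \<le> m\<close> \<open>0 < q\<close> by (intro mult_left_mono powr_mono2) auto
      also have "\<dots> = 1"
        using \<open>0 < m\<close> by (simp add: c_powr)
      finally show "cmod (of_real c + z * of_real (c * \<delta>)) powr q
          + cmod (of_real c + z * of_real (- c * \<delta>)) powr q \<le> 1"
        unfolding eqs .
    next
      \<comment> \<open>Both coefficient norms carry the factor \<open>m powr (- (p / 2))\<close>;
        cleared of it, the goal reads
        \<open>m powr (p / 2) < 1 + \<delta> powr p * \<rho> powr p\<close>.\<close>
      have "m powr (p / 2) \<le> 1 + p / 2 * \<delta>\<^sup>2"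
        using powr_le_tangent[of "p / 2" m] pq \<open>0 < p\<close> \<open>0 < m\<close> by (simp add: m_def)
      also have "\<dots> \<le> 1 + \<delta>\<^sup>2"
        using pq \<open>0 < p\<close> by (intro add_left_mono mult_left_le_one_le) auto
      also have "\<delta>\<^sup>2 = \<delta> powr p * \<delta> powr (2 - p)"
        using \<delta> by (simp flip: powr_add)
      also have "1 + \<delta> powr p * \<delta> powr (2 - p) < 1 + \<delta> powr p * \<rho> powr p"
        using \<delta> by simp
      finally have "m powr (- (p / 2)) * m powr (p / 2)
          < m powr (- (p / 2)) * (1 + \<delta> powr p * \<rho> powr p)"
        using \<open>0 < m\<close> by simp
      then have "1 < m powr (- (p / 2)) + m powr (- (p / 2)) * \<delta> powr p * \<rho> powr p"
        using \<open>0 < m\<close> by (simp add: algebra_simps flip: powr_add)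
      \<comment> \<open>The coordinates of the first coefficient are those of the zeroth scaled by
        \<delta> up to sign, so \<open>norm0\<close> applies again.\<close>
      moreover have "((c * \<delta>) powr q + (c * \<delta>) powr q) powr (p / q) = m powr (- (p / 2)) * \<delta> powr p"
      proof -
        have sum: "(c * \<delta>) powr q + (c * \<delta>) powr q = (c powr q + c powr q) * \<delta> powr q"
          by (simp add: powr_mult algebra_simps)
        show ?thesis
          unfolding sum unfolding powr_mult norm0 using \<open>0 < q\<close> by (simp add: powr_powr)
      qed
      moreover have "cmod (of_real c) = c" "cmod (of_real (c * \<delta>)) = c * \<delta>"
        "cmod (of_real (- c * \<delta>)) = c * \<delta>"
        unfolding norm_of_real using \<open>0 < c\<close> \<delta> by (simp_all add: abs_mult)
      ultimately show "1 < (cmod (of_real c) powr q + cmod (of_real c) powr q) powr (p / q)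
          + (cmod (of_real (c * \<delta>)) powr q + cmod (of_real (- c * \<delta>)) powr q) powr (p / q)
            * \<rho> powr p"
        by (simp only: norm0)
    qed (use \<open>0 < \<rho>\<close> in auto)
  qed
  have "bohr_radius p N (Lq M q) \<le> 0"
    by (rule ennreal_le_epsilon) (simp add: small)
  then show ?thesis by simp
qed

end
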